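(* The minimum value function $F$ and its one-sided derivatives $D^{\pm}F$ satisfy \[ \lim_{\alpha\downarrow 0}F(\alpha)=\inf_{x\in Q_{\mathrm{ad}}}\varphi(x,y^\delta),\qquad \lim_{\alpha\downarrow 0}\alpha\, D^{+}F(\alpha)=0,\qquad \lim_{\alpha\downarrow 0}\alpha\, D^{-}F(\alpha)=0 . \]
   Context: Let $X,Y$ be Banach spaces, $Q_{\mathrm{ad}}\subset X$ a nonempty admissible set, $y^\delta\in Y$ fixed data, and let $\varphi(\cdot,y^\delta):Q_{\mathrm{ad}}\to[0,\infty)$ (fidelity functional) and $\psi:Q_{\mathrm{ad}}\to[0,\infty)$ (regularization functional) be given. For $\alpha>0$ put $J_\alpha(x)=\varphi(x,y^\delta)+\alpha\psi(x)$, and define the minimum value function $F(\alpha)=\inf_{x\in Q_{\mathrm{ad}}}J_\alpha(x)$, $\alpha>0$. The one-sided derivatives are denoted (note the convention: $D^+$ is the derivative from the left, $D^-$ the derivative from the right) \[ D^{+}F(\alpha)=\lim_{h\downarrow 0}\frac{F(\alpha)-F(\alpha-h)}{h},\qquad D^{-}F(\alpha)=\lim_{h\downarrow 0}\frac{F(\alpha+h)-F(\alpha)}{h}; \] both limits exist for every $\alpha>0$ because $F$ is concave. *)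

theory Defs
  imports "HOL-Analysis.Analysis"
begin

definition J_fun ::
    "('a \<Rightarrow> 'b \<Rightarrow> real) \<Rightarrow> ('a \<Rightarrow> real) \<Rightarrow> 'b \<Rightarrow> real \<Rightarrow> 'a \<Rightarrow> real"
  where "J_fun \<phi> \<psi> y \<alpha> x = \<phi> x y + \<alpha> * \<psi> x"

(* Only meaningful for \<alpha> > 0 and nonempty Q, with \<phi> and \<psi> nonnegative on Q: then the real-valued
   infimum is over a nonempty set that is bounded below. *)
definition min_value ::
    "'a set \<Rightarrow> ('a \<Rightarrow> 'b \<Rightarrow> real) \<Rightarrow> ('a \<Rightarrow> real) \<Rightarrow> 'b \<Rightarrow> real \<Rightarrow> real"
  where "min_value Q \<phi> \<psi> y \<alpha> = (INF x\<in>Q. J_fun \<phi> \<psi> y \<alpha> x)"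

(* Convention: D_plus is the derivative from the left, D_minus the derivative from the right.
   Lim is a definite description and is meaningful only if the limit exists; for min_value this is
   shown in min_value_D_plus and min_value_D_minus below. *)
definition D_plus :: "(real \<Rightarrow> real) \<Rightarrow> real \<Rightarrow> real"
  where "D_plus F \<alpha> = Lim (at_right 0) (\<lambda>h. (F \<alpha> - F (\<alpha> - h)) / h)"

definition D_minus :: "(real \<Rightarrow> real) \<Rightarrow> real \<Rightarrow> real"
  where "D_minus F \<alpha> = Lim (at_right 0) (\<lambda>h. (F (\<alpha> + h) - F \<alpha>) / h)"

lemma min_value_concave:
  assumes "Q \<noteq> {}" and "\<And>x. x \<in> Q \<Longrightarrow> 0 \<le> \<phi> x y" and "\<And>x. x \<in> Q \<Longrightarrow> 0 \<le> \<psi> x"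
  shows "concave_on {0<..} (min_value Q \<phi> \<psi> y)"
  unfolding concave_on_iff
proof (intro conjI ballI allI impI)
  show "convex {0::real<..}" by simp
next
  fix a b u v :: real
  assume ab: "a \<in> {0<..}" "b \<in> {0<..}" and uv: "0 \<le> u" "0 \<le> v" "u + v = 1"
  have le: "min_value Q \<phi> \<psi> y c \<le> J_fun \<phi> \<psi> y c x" if "x \<in> Q" "0 < c" for c x
    unfolding min_value_def
    by (rule cINF_lower[OF bdd_belowI2[where m = 0] that(1)])
      (use assms that in \<open>auto simp: J_fun_def\<close>)
  show "u * min_value Q \<phi> \<psi> y a + v * min_value Q \<phi> \<psi> y b
          \<le> min_value Q \<phi> \<psi> y (u *\<^sub>R a + v *\<^sub>R b)"
    unfolding min_value_def[of Q \<phi> \<psi> y "u *\<^sub>R a + v *\<^sub>R b"]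
  proof (rule cINF_greatest[OF assms(1)])
    fix x assume x: "x \<in> Q"
    have "u * min_value Q \<phi> \<psi> y a + v * min_value Q \<phi> \<psi> y b
            \<le> u * J_fun \<phi> \<psi> y a x + v * J_fun \<phi> \<psi> y b x"
      using le[OF x] ab uv by (intro add_mono mult_left_mono) auto
    also have "\<dots> = (u + v) * \<phi> x y + (u * a + v * b) * \<psi> x"
      by (simp add: J_fun_def algebra_simps)
    finally show "u * min_value Q \<phi> \<psi> y a + v * min_value Q \<phi> \<psi> y b
                    \<le> J_fun \<phi> \<psi> y (u *\<^sub>R a + v *\<^sub>R b) x"
      using uv by (simp add: J_fun_def)
  qed
qed

lemma tendsto_Lim_at_right_antimono:
  fixes g :: "real \<Rightarrow> real"
  assumes r: "0 < r" and anti: "\<And>h k. 0 < h \<Longrightarrow> h \<le> k \<Longrightarrow> k < r \<Longrightarrow> g k \<le> g h"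
    and bnd: "\<And>h. 0 < h \<Longrightarrow> h < r \<Longrightarrow> g h \<le> B"
  shows "(g \<longlongrightarrow> Lim (at_right 0) g) (at_right 0)"
proof -
  define S where "S = (SUP h\<in>{0<..<r}. g h)"
  have bdd: "bdd_above (g ` {0<..<r})" using bnd by (auto intro!: bdd_aboveI2)
  have "(g \<longlongrightarrow> S) (at_right 0)"
  proof (rule order_tendstoI)
    fix c assume "c < S"
    then obtain k where k: "0 < k" "k < r" "c < g k"
      using less_cSUP_iff[of "{0<..<r}" g c] bdd r by (auto simp: S_def)
    show "\<forall>\<^sub>F h in at_right 0. c < g h"
      using eventually_at_right_less[of 0] eventually_at_right_real[OF k(1)]
    proof eventually_elim
      case (elim h)
      then show ?case using anti[of h k] k by auto
    qed
  next
    fix c assume c: "S < c"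
    show "\<forall>\<^sub>F h in at_right 0. g h < c"
      using eventually_at_right_real[OF r]
    proof eventually_elim
      case (elim h)
      then show ?case using cSUP_upper[OF elim bdd] c by (simp add: S_def)
    qed
  qed
  then show ?thesis using tendsto_Lim[OF trivial_limit_at_right_real] by metis
qed

lemma concave_slopes:
  fixes F :: "real \<Rightarrow> real"
  assumes "concave_on {0<..} F" and "0 < a" "a < b" "b < c"
  shows "(F c - F a) / (c - a) \<le> (F b - F a) / (b - a)"
    and "(F c - F b) / (c - b) \<le> (F c - F a) / (c - a)"
    and "(F c - F b) / (c - b) \<le> (F b - F a) / (b - a)"
proof -
  define t where "t = (b - a) / (c - a)"
  have t: "0 \<le> t" "1 - t \<ge> 0" "t * (c - a) = b - a"
    using assms by (auto simp: t_def divide_simps)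
  have b: "(1 - t) * a + t * c = b" using t(3) by (simp add: algebra_simps)
  have "(1 - t) * F a + t * F c \<le> F b"
    using assms t b unfolding concave_on_iff by fastforce
  then have "(c - a) * ((1 - t) * F a + t * F c) \<le> (c - a) * F b"
    using assms by (intro mult_left_mono) auto
  moreover have "(c - a) * ((1 - t) * F a + t * F c)
      = (c - a) * F a + t * (c - a) * (F c - F a)"
    by (simp add: algebra_simps)
  ultimately have key: "(b - a) * (F c - F a) \<le> (c - a) * (F b - F a)"
    unfolding t(3) by (simp add: algebra_simps)
  show "(F c - F a) / (c - a) \<le> (F b - F a) / (b - a)"
    "(F c - F b) / (c - b) \<le> (F c - F a) / (c - a)"
    "(F c - F b) / (c - b) \<le> (F b - F a) / (b - a)"
    using key assms by (simp_all add: frac_le_eq divide_le_0_iff field_simps)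
qed

lemma concave_D_plus:
  fixes F :: "real \<Rightarrow> real"
  assumes conc: "concave_on {0<..} F" and "0 < \<alpha>"
  shows "((\<lambda>h. (F \<alpha> - F (\<alpha> - h)) / h) \<longlongrightarrow> D_plus F \<alpha>) (at_right 0)"
proof -
  let ?g = "\<lambda>h. (F \<alpha> - F (\<alpha> - h)) / h"
  have "((\<lambda>h. - ?g h) \<longlongrightarrow> Lim (at_right 0) (\<lambda>h. - ?g h)) (at_right 0)"
  proof (rule tendsto_Lim_at_right_antimono[OF \<open>0 < \<alpha>\<close>])
    fix h k :: real assume *: "0 < h" "h \<le> k" "k < \<alpha>"
    then show "- ?g k \<le> - ?g h"
      using concave_slopes(2)[OF conc, of "\<alpha> - k" "\<alpha> - h" \<alpha>] by (cases "h = k") auto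
  next
    fix h :: real assume "0 < h" "h < \<alpha>"
    then show "- ?g h \<le> - (F (\<alpha> + 1) - F \<alpha>)"
      using concave_slopes(3)[OF conc, of "\<alpha> - h" \<alpha> "\<alpha> + 1"] by auto
  qed
  from tendsto_minus[OF this] show ?thesis
    unfolding D_plus_def using tendsto_Lim[OF trivial_limit_at_right_real]
    by (metis (no_types, lifting) ext minus_minus)
qed

lemma concave_D_minus:
  fixes F :: "real \<Rightarrow> real"
  assumes conc: "concave_on {0<..} F" and "0 < \<alpha>"
  shows "((\<lambda>h. (F (\<alpha> + h) - F \<alpha>) / h) \<longlongrightarrow> D_minus F \<alpha>) (at_right 0)"
  unfolding D_minus_def
proof (rule tendsto_Lim_at_right_antimono[OF zero_less_one])
  fix h k :: real assume "0 < h" "h \<le> k" "k < 1"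
  then show "(F (\<alpha> + k) - F \<alpha>) / k \<le> (F (\<alpha> + h) - F \<alpha>) / h"
    using concave_slopes(1)[OF conc \<open>0 < \<alpha>\<close>, of "\<alpha> + h" "\<alpha> + k"] by (cases "h = k") auto
next
  fix h :: real assume "0 < h" "h < 1"
  then show "(F (\<alpha> + h) - F \<alpha>) / h \<le> (F \<alpha> - F (\<alpha> / 2)) / (\<alpha> / 2)"
    using concave_slopes(3)[OF conc, of "\<alpha> / 2" \<alpha> "\<alpha> + h"] \<open>0 < \<alpha>\<close> by auto
qed

lemmas min_value_D_plus = concave_D_plus[OF min_value_concave]
lemmas min_value_D_minus = concave_D_minus[OF min_value_concave]

end

theory Submission
  imports Defs "HOL-Real_Asymp.Real_Asymp"
begin

text \<open>
  An infimum of functions that are affine and nondecreasing in \<open>\<alpha>\<close>, the minimum value function is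
  concave and nondecreasing. Its limit at \<open>0\<close> amounts to an exchange of two infima: since \<open>\<psi> \<ge> 0\<close>,
  it never falls below \<open>INF x\<in>Q. \<phi> x y\<close>, while a single almost minimizing \<open>x\<close> gives the upper bound
  \<open>\<phi> x y + \<alpha> * \<psi> x\<close>, which tends to \<open>\<phi> x y\<close> (\<open>tendsto_min_value_at_0\<close>).

  The claims on the derivatives use only that \<open>F\<close> is concave, nondecreasing and has a limit at \<open>0\<close>.
  By concavity, both one-sided derivatives at \<open>\<alpha>\<close> are at most the slope of the chord over
  \<open>[\<alpha>/2, \<alpha>]\<close>, so that \<open>0 \<le> \<alpha> * D F \<alpha> \<le> 2 * (F \<alpha> - F (\<alpha>/2))\<close>. The right-hand side is twice a
  difference of two values of \<open>F\<close> with the same limit (\<open>concave_mono_times_derivatives_at_0\<close>).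
\<close>

lemma min_value_le:
  assumes "\<And>x. x \<in> Q \<Longrightarrow> 0 \<le> \<phi> x y" and "\<And>x. x \<in> Q \<Longrightarrow> 0 \<le> \<psi> x" and "x \<in> Q" "0 < \<alpha>"
  shows "min_value Q \<phi> \<psi> y \<alpha> \<le> \<phi> x y + \<alpha> * \<psi> x"
proof -
  have "bdd_below (J_fun \<phi> \<psi> y \<alpha> ` Q)"
    using assms by (intro bdd_belowI2[where m = 0]) (auto simp: J_fun_def)
  from cINF_lower[OF this \<open>x \<in> Q\<close>] show ?thesis
    by (simp add: min_value_def J_fun_def)
qed

lemma min_value_mono:
  assumes "Q \<noteq> {}" and "\<And>x. x \<in> Q \<Longrightarrow> 0 \<le> \<phi> x y" and "\<And>x. x \<in> Q \<Longrightarrow> 0 \<le> \<psi> x"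
    and "0 < \<alpha>" "\<alpha> \<le> \<beta>"
  shows "min_value Q \<phi> \<psi> y \<alpha> \<le> min_value Q \<phi> \<psi> y \<beta>"
  unfolding min_value_def[of Q \<phi> \<psi> y \<beta>]
proof (rule cINF_greatest[OF assms(1)])
  fix x assume x: "x \<in> Q"
  have "min_value Q \<phi> \<psi> y \<alpha> \<le> \<phi> x y + \<alpha> * \<psi> x"
    using assms x by (intro min_value_le)
  also have "\<dots> \<le> \<phi> x y + \<beta> * \<psi> x"
    using assms x by (intro add_left_mono mult_right_mono) auto
  finally show "min_value Q \<phi> \<psi> y \<alpha> \<le> J_fun \<phi> \<psi> y \<beta> x"
    by (simp add: J_fun_def)
qed

text \<open>
  The infimum over \<open>\<phi>\<close> need not be attained. This is no obstacle, because the upper bound needs only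
  one point \<open>x\<close> for each level \<open>c\<close> above the infimum, and this point does not depend on \<open>\<alpha>\<close>.
\<close>

lemma tendsto_min_value_at_0:
  assumes "Q \<noteq> {}" and "\<And>x. x \<in> Q \<Longrightarrow> 0 \<le> \<phi> x y" and "\<And>x. x \<in> Q \<Longrightarrow> 0 \<le> \<psi> x"
  shows "(min_value Q \<phi> \<psi> y \<longlongrightarrow> (INF x\<in>Q. \<phi> x y)) (at_right 0)"
proof (rule order_tendstoI)
  have bdd: "bdd_below ((\<lambda>x. \<phi> x y) ` Q)"
    using assms(2) by (intro bdd_belowI2[where m = 0])
  {
    fix c assume c: "c < (INF x\<in>Q. \<phi> x y)"
    show "\<forall>\<^sub>F \<alpha> in at_right 0. c < min_value Q \<phi> \<psi> y \<alpha>"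
      using eventually_at_right_less[of 0]
    proof eventually_elim
      case (elim \<alpha>)
      have "(INF x\<in>Q. \<phi> x y) \<le> min_value Q \<phi> \<psi> y \<alpha>"
        unfolding min_value_def
      proof (rule cINF_greatest[OF assms(1)])
        fix x assume x: "x \<in> Q"
        have "(INF x\<in>Q. \<phi> x y) \<le> \<phi> x y" by (rule cINF_lower[OF bdd x])
        also have "\<dots> \<le> J_fun \<phi> \<psi> y \<alpha> x" using assms(3)[OF x] elim by (simp add: J_fun_def)
        finally show "(INF x\<in>Q. \<phi> x y) \<le> J_fun \<phi> \<psi> y \<alpha> x" .
      qed
      with c show ?case by simp
    qed
  next
    fix c assume "(INF x\<in>Q. \<phi> x y) < c"
    then obtain x where x: "x \<in> Q" "\<phi> x y < c"
      using cINF_less_iff[OF assms(1) bdd] by auto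
    have "((\<lambda>\<alpha>. \<phi> x y + \<alpha> * \<psi> x) \<longlongrightarrow> \<phi> x y + 0 * \<psi> x) (at_right 0)"
      by (intro tendsto_intros)
    then have "\<forall>\<^sub>F \<alpha> in at_right 0. \<phi> x y + \<alpha> * \<psi> x < c"
      using x(2) by (intro order_tendstoD(2)) auto
    with eventually_at_right_less[of 0]
    show "\<forall>\<^sub>F \<alpha> in at_right 0. min_value Q \<phi> \<psi> y \<alpha> < c"
    proof eventually_elim
      case (elim \<alpha>)
      then show ?case using min_value_le[of Q \<phi> y \<psi> x \<alpha>] assms x(1) by fastforce
    qed
  }
qed

text \<open>
  Slopes of chords decrease from left to right. The chord over \<open>[\<alpha>/2, \<alpha>]\<close> has both endpoints inside
  the domain and a length proportional to \<open>\<alpha>\<close>, which cancels the factor \<open>\<alpha>\<close>.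
\<close>

lemma concave_mono_times_derivative_bounds:
  fixes F :: "real \<Rightarrow> real"
  assumes conc: "concave_on {0<..} F" and mono: "\<And>a b. 0 < a \<Longrightarrow> a \<le> b \<Longrightarrow> F a \<le> F b"
    and "0 < \<alpha>"
  shows "0 \<le> \<alpha> * D_plus F \<alpha>" and "\<alpha> * D_plus F \<alpha> \<le> 2 * (F \<alpha> - F (\<alpha> / 2))"
    and "0 \<le> \<alpha> * D_minus F \<alpha>" and "\<alpha> * D_minus F \<alpha> \<le> 2 * (F \<alpha> - F (\<alpha> / 2))"
proof -
  let ?s = "(F \<alpha> - F (\<alpha> / 2)) / (\<alpha> / 2)"
  have near: "\<forall>\<^sub>F h in at_right 0. h \<in> {0<..<\<alpha> / 2}"
    using \<open>0 < \<alpha>\<close> by (intro eventually_at_right_real) simp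
  have left: "0 \<le> (F \<alpha> - F (\<alpha> - h)) / h \<and> (F \<alpha> - F (\<alpha> - h)) / h \<le> ?s"
    if "h \<in> {0<..<\<alpha> / 2}" for h
    using concave_slopes(2)[OF conc, of "\<alpha> / 2" "\<alpha> - h" \<alpha>] mono[of "\<alpha> - h" \<alpha>] that by auto
  have right: "0 \<le> (F (\<alpha> + h) - F \<alpha>) / h \<and> (F (\<alpha> + h) - F \<alpha>) / h \<le> ?s"
    if "h \<in> {0<..<\<alpha> / 2}" for h
    using concave_slopes(3)[OF conc, of "\<alpha> / 2" \<alpha> "\<alpha> + h"] mono[of \<alpha> "\<alpha> + h"] that by auto
  have "0 \<le> D_plus F \<alpha>" "D_plus F \<alpha> \<le> ?s"
    using left by (auto intro!: tendsto_lowerbound[OF concave_D_plus[OF conc \<open>0 < \<alpha>\<close>]]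
        tendsto_upperbound[OF concave_D_plus[OF conc \<open>0 < \<alpha>\<close>]] eventually_mono[OF near])
  moreover have "0 \<le> D_minus F \<alpha>" "D_minus F \<alpha> \<le> ?s"
    using right by (auto intro!: tendsto_lowerbound[OF concave_D_minus[OF conc \<open>0 < \<alpha>\<close>]]
        tendsto_upperbound[OF concave_D_minus[OF conc \<open>0 < \<alpha>\<close>]] eventually_mono[OF near])
  ultimately show "0 \<le> \<alpha> * D_plus F \<alpha>" "\<alpha> * D_plus F \<alpha> \<le> 2 * (F \<alpha> - F (\<alpha> / 2))"
    "0 \<le> \<alpha> * D_minus F \<alpha>" "\<alpha> * D_minus F \<alpha> \<le> 2 * (F \<alpha> - F (\<alpha> / 2))"
    using \<open>0 < \<alpha>\<close> by (simp_all add: field_simps)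
qed

lemma concave_mono_times_derivatives_at_0:
  fixes F :: "real \<Rightarrow> real"
  assumes conc: "concave_on {0<..} F" and mono: "\<And>a b. 0 < a \<Longrightarrow> a \<le> b \<Longrightarrow> F a \<le> F b"
    and lim: "(F \<longlongrightarrow> L) (at_right 0)"
  shows "((\<lambda>\<alpha>. \<alpha> * D_plus F \<alpha>) \<longlongrightarrow> 0) (at_right 0)"
    and "((\<lambda>\<alpha>. \<alpha> * D_minus F \<alpha>) \<longlongrightarrow> 0) (at_right 0)"
proof -
  have "filterlim (\<lambda>\<alpha>::real. \<alpha> / 2) (at_right 0) (at_right 0)"
    by real_asymp
  then have "((\<lambda>\<alpha>. 2 * (F \<alpha> - F (\<alpha> / 2))) \<longlongrightarrow> 2 * (L - L)) (at_right 0)"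
    by (intro tendsto_intros lim filterlim_compose[OF lim])
  then have upper: "((\<lambda>\<alpha>. 2 * (F \<alpha> - F (\<alpha> / 2))) \<longlongrightarrow> 0) (at_right 0)"
    by simp
  note bounds = concave_mono_times_derivative_bounds[OF conc mono]
  show "((\<lambda>\<alpha>. \<alpha> * D_plus F \<alpha>) \<longlongrightarrow> 0) (at_right 0)"
    by (rule tendsto_sandwich[OF _ _ tendsto_const upper];
        rule eventually_mono[OF eventually_at_right_less]) (use bounds(1,2) in auto)
  show "((\<lambda>\<alpha>. \<alpha> * D_minus F \<alpha>) \<longlongrightarrow> 0) (at_right 0)"
    by (rule tendsto_sandwich[OF _ _ tendsto_const upper];
        rule eventually_mono[OF eventually_at_right_less]) (use bounds(3,4) in auto)
qed

theorem proposition1: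
  fixes Q :: "'a::banach set"
    and \<phi> :: "'a \<Rightarrow> 'b::banach \<Rightarrow> real"
    and \<psi> :: "'a \<Rightarrow> real"
    and y :: 'b
  assumes "Q \<noteq> {}"
    and "\<And>x. x \<in> Q \<Longrightarrow> 0 \<le> \<phi> x y"
    and "\<And>x. x \<in> Q \<Longrightarrow> 0 \<le> \<psi> x"
  shows "(min_value Q \<phi> \<psi> y \<longlongrightarrow> (INF x\<in>Q. \<phi> x y)) (at_right 0)
       \<and> ((\<lambda>\<alpha>. \<alpha> * D_plus (min_value Q \<phi> \<psi> y) \<alpha>) \<longlongrightarrow> 0) (at_right 0)
       \<and> ((\<lambda>\<alpha>. \<alpha> * D_minus (min_value Q \<phi> \<psi> y) \<alpha>) \<longlongrightarrow> 0) (at_right 0)"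
proof -
  have conc: "concave_on {0<..} (min_value Q \<phi> \<psi> y)"
    using assms by (rule min_value_concave)
  have mono: "min_value Q \<phi> \<psi> y a \<le> min_value Q \<phi> \<psi> y b" if "0 < a" "a \<le> b" for a b
    using assms that by (rule min_value_mono)
  have lim: "(min_value Q \<phi> \<psi> y \<longlongrightarrow> (INF x\<in>Q. \<phi> x y)) (at_right 0)"
    using assms by (rule tendsto_min_value_at_0)
  show ?thesis
    using lim concave_mono_times_derivatives_at_0[OF conc mono lim] by blast
qed

end
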